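(* Let $(S,\mathcal{S},\mu)$ be a space of finite measure and $\xi$ a random measure on $S$ that is $\mu$-swap-invariant under a probability measure $\mathbf{P}$ with $\mathbf{E}_{\mathbf{P}}\,\xi(S)\in(0,\infty)$. Then there exists a random measure $\eta$ on $S$ that is $\mu$-exchangeable under the probability measure $\mathbf{Q}$ defined by $$\frac{\mathrm{d}\mathbf{Q}}{\mathrm{d}\mathbf{P}}=\frac{\xi(S)}{\mathbf{E}_{\mathbf{P}}\,\xi(S)}$$ such that $\xi=\xi(S)\,\eta$ $\mathbf{P}$-almost surely.
   Context: A random measure $\xi$ on a measurable space $(S,\mathcal{S})$, defined over a probability space $(\Omega,\mathcal{F},\mathbf{P})$, is a map $\xi:\Omega\times\mathcal{S}\to[0,\infty]$ such that $\xi(M)=\xi(\cdot,M)$ is measurable for each $M\in\mathcal{S}$ and $\xi(\omega,\cdot)$ is a measure for each $\omega\in\Omega$. $\mu$-swap-invariant: $\mathbf{E}\,\big|\sum_{j=1}^n u_j\xi(A_j)\big|=\mathbf{E}\,\big|\sum_{j=1}^n u_j\xi(B_j)\big|$ for all $n\ge1$, $u\in\mathbb{R}^n$, disjoint $A_1,\dots,A_n\in\mathcal{S}$ and disjoint $B_1,\dots,B_n\in\mathcal{S}$ such that $\mu(A_j)=\mu(B_j)$, $\mathbf{E}\,\xi(A_j)<\infty$ and $\mathbf{E}\,\xi(B_j)<\infty$ for $1\le j\le n$. $\mu$-exchangeable: $(\xi(A_1),\dots,\xi(A_n))$ and $(\xi(B_1),\dots,\xi(B_n))$ are equal in distribution for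 all $n\ge 1$, all disjoint $A_1,\dots,A_n\in\mathcal{S}$ and all disjoint $B_1,\dots,B_n\in\mathcal{S}$ with $\mu(A_j)=\mu(B_j)$ for $1\le j\le n$. $\mathbf{E}_{\mathbf{P}}$ denotes expectation with respect to $\mathbf{P}$. *)

theory Defs
  imports "HOL-Probability.Probability"
begin

text \<open>
  A random measure is a map into the type of measures. The measurable space on which the
  measures live, and likewise the underlying measurable space of events, are given by the space
  and sigma-algebra of a value of type \<^typ>\<open>'s measure\<close>; the values of that measure are ignored
  in the following definition.
\<close>

definition random_measure :: "'w measure \<Rightarrow> 's measure \<Rightarrow> ('w \<Rightarrow> 's measure) \<Rightarrow> bool" where
  "random_measure P S \<xi> \<longleftrightarrow>
     (\<forall>\<omega>\<in>space P. sets (\<xi> \<omega>) = sets S) \<and>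
     (\<forall>M\<in>sets S. (\<lambda>\<omega>. emeasure (\<xi> \<omega>) M) \<in> borel_measurable P)"

text \<open>
  In the linear combinations below, \<^const>\<open>measure\<close> is the real-valued version of
  \<^const>\<open>emeasure\<close>. It differs from the latter only where the value is infinite, which by the
  assumption of finite expectations happens on a null set only. For the same reason, for a random
  measure, the integrands are integrable, so the Bochner integral is the true expectation.
\<close>

definition swap_invariant :: "'s measure \<Rightarrow> 'w measure \<Rightarrow> ('w \<Rightarrow> 's measure) \<Rightarrow> bool" where
  "swap_invariant \<mu> P \<xi> \<longleftrightarrow>
     (\<forall>n\<ge>1. \<forall>(u :: nat \<Rightarrow> real) A B.
        (\<forall>j\<in>{1..n}. A j \<in> sets \<mu> \<and> B j \<in> sets \<mu>) \<longrightarrow>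
        disjoint_family_on A {1..n} \<longrightarrow> disjoint_family_on B {1..n} \<longrightarrow>
        (\<forall>j\<in>{1..n}. emeasure \<mu> (A j) = emeasure \<mu> (B j) \<and>
           (\<integral>\<^sup>+\<omega>. emeasure (\<xi> \<omega>) (A j) \<partial>P) < \<infinity> \<and>
           (\<integral>\<^sup>+\<omega>. emeasure (\<xi> \<omega>) (B j) \<partial>P) < \<infinity>) \<longrightarrow>
        (\<integral>\<omega>. \<bar>\<Sum>j=1..n. u j * measure (\<xi> \<omega>) (A j)\<bar> \<partial>P) =
        (\<integral>\<omega>. \<bar>\<Sum>j=1..n. u j * measure (\<xi> \<omega>) (B j)\<bar> \<partial>P))"

definition exchangeable :: "'s measure \<Rightarrow> 'w measure \<Rightarrow> ('w \<Rightarrow> 's measure) \<Rightarrow> bool" where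
  "exchangeable \<mu> P \<xi> \<longleftrightarrow>
     (\<forall>n\<ge>1. \<forall>A B.
        (\<forall>j\<in>{1..n::nat}. A j \<in> sets \<mu> \<and> B j \<in> sets \<mu>) \<longrightarrow>
        disjoint_family_on A {1..n} \<longrightarrow> disjoint_family_on B {1..n} \<longrightarrow>
        (\<forall>j\<in>{1..n}. emeasure \<mu> (A j) = emeasure \<mu> (B j)) \<longrightarrow>
        distr P (\<Pi>\<^sub>M j\<in>{1..n}. borel) (\<lambda>\<omega>. \<lambda>j\<in>{1..n}. emeasure (\<xi> \<omega>) (A j)) =
        distr P (\<Pi>\<^sub>M j\<in>{1..n}. borel) (\<lambda>\<omega>. \<lambda>j\<in>{1..n}. emeasure (\<xi> \<omega>) (B j)))"

end

theory Submission
  imports Defs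
begin

text \<open>
  Put \<open>\<eta> = \<xi> / \<xi>(S)\<close>. Since \<open>\<mu>\<close> is finite, sets \<open>A\<^sub>1, \<dots>, A\<^sub>n\<close> can be completed to a partition
  of \<open>S\<close> by a set whose \<open>\<mu>\<close>-measure depends only on the \<open>\<mu>(A\<^sub>j)\<close>. Swap-invariance for such
  partitions, divided by \<open>\<xi>(S)\<close>, says that \<open>E\<^sub>Q |\<Sum> t\<^sub>j \<eta>(A\<^sub>j) - c|\<close> is
  unchanged when the \<open>A\<^sub>j\<close> are replaced by the \<open>B\<^sub>j\<close>. The difference quotients in \<open>c\<close> determine
  the law of \<open>\<Sum> t\<^sub>j \<eta>(A\<^sub>j)\<close> under \<open>Q\<close>. As \<open>\<eta>\<close> takes values in \<open>[0,1]\<close>, the Cramer-Wold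
  theorem is only needed on a compact set, where the linear span of the exponentials
  \<open>exp (\<Sum> t\<^sub>j x\<^sub>j)\<close> is a dense algebra by Stone-Weierstrass.
\<close>

section \<open>Laws on the real line and absolute moments about a point\<close>

text \<open>The function c -> E|X - c| has right derivative 2 F(c) - 1, where F is the distribution
  function of X. It therefore determines F, and with it the law.\<close>

lemma (in prob_space) distr_eqI_abs_moments:
  fixes X Y :: "'a \<Rightarrow> real"
  assumes X: "integrable M X" and Y: "integrable M Y"
    and eq: "\<And>c. (\<integral>\<omega>. \<bar>X \<omega> - c\<bar> \<partial>M) = (\<integral>\<omega>. \<bar>Y \<omega> - c\<bar> \<partial>M)"
  shows "distr M borel X = distr M borel Y"
proof (rule cdf_unique)
  have [measurable]: "X \<in> borel_measurable M" "Y \<in> borel_measurable M"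
    using X Y by auto
  interpret DX: prob_space "distr M borel X" by (rule prob_space_distr) simp
  interpret DY: prob_space "distr M borel Y" by (rule prob_space_distr) simp
  show "real_distribution (distr M borel X)" "real_distribution (distr M borel Y)"
    by (auto intro!: real_distribution.intro real_distribution_axioms.intro DX.prob_space_axioms DY.prob_space_axioms)
  show "cdf (distr M borel X) = cdf (distr M borel Y)"
  proof
    fix c :: real
    \<comment> \<open>Up to sign, \<open>h n x\<close> is the forward difference quotient of |x - c|
      in c with step 1/(n+1). Stepping forward gives the limit -1 at x = c as well, which matches
      the closed half-line in \<open>cdf\<close>.\<close>
    define h where "h n x = real (Suc n) * (\<bar>x - c\<bar> - \<bar>x - (c + 1 / real (Suc n))\<bar>)" for n x
    have h_bound: "\<bar>h n x\<bar> \<le> 1" for n x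
    proof -
      have "\<bar>\<bar>x - c\<bar> - \<bar>x - (c + 1 / real (Suc n))\<bar>\<bar> \<le> 1 / real (Suc n)"
        by (smt (verit) divide_nonneg_nonneg of_nat_0_le_iff)
      then show ?thesis
        unfolding h_def abs_mult by (simp add: field_simps del: of_nat_Suc)
    qed
    have h_lim: "(\<lambda>n. h n x) \<longlonglongrightarrow> 1 - 2 * indicator {..c} x" for x
    proof (cases "x \<le> c")
      case True
      then have "h n x = -1" for n
      proof -
        have "\<bar>x - c\<bar> - \<bar>x - (c + 1 / real (Suc n))\<bar> = - (1 / real (Suc n))"
          using True by (smt (verit) divide_nonneg_nonneg of_nat_0_le_iff)
        then show ?thesis by (simp add: h_def del: of_nat_Suc)
      qed
      then show ?thesis using True by simp
    next
      case False
      then have "\<forall>\<^sub>F n in sequentially. 1 / real (Suc n) < x - c"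
        using order_tendstoD(2)[OF LIMSEQ_inverse_real_of_nat, of "x - c"]
        by (simp add: inverse_eq_divide)
      then have "\<forall>\<^sub>F n in sequentially. h n x = 1"
      proof eventually_elim
        case (elim n)
        then have "\<bar>x - c\<bar> - \<bar>x - (c + 1 / real (Suc n))\<bar> = 1 / real (Suc n)"
          using False by linarith
        then show ?case by (simp add: h_def del: of_nat_Suc)
      qed
      then show ?thesis using False by (simp add: tendsto_eventually)
    qed
    have lim: "(\<lambda>n. \<integral>\<omega>. h n (Z \<omega>) \<partial>M) \<longlonglongrightarrow> 1 - 2 * cdf (distr M borel Z) c"
      if Z[measurable]: "Z \<in> borel_measurable M" for Z
    proof -
      have [measurable]: "h n \<in> borel_measurable borel" for n
        unfolding h_def by measurable
      have "(\<lambda>n. \<integral>\<omega>. h n (Z \<omega>) \<partial>M) \<longlonglongrightarrow> (\<integral>\<omega>. (1 :: real) - 2 * indicator {..c} (Z \<omega>) \<partial>M)"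
        by (rule integral_dominated_convergence[where w = "\<lambda>_. 1"]) (use h_lim h_bound in auto)
      also have "(\<integral>\<omega>. (1 :: real) - 2 * indicator {..c} (Z \<omega>) \<partial>M) =
          1 - 2 * (\<integral>\<omega>. indicator {..c} (Z \<omega>) \<partial>M)"
      proof -
        have "integrable M (\<lambda>\<omega>. indicator {..c} (Z \<omega>) :: real)"
          by (intro integrable_const_bound[where B = 1]) auto
        then show ?thesis by (simp add: prob_space)
      qed
      also have "(\<integral>\<omega>. indicat_real {..c} (Z \<omega>) \<partial>M) = (\<integral>x. indicator {..c} x \<partial>distr M borel Z)"
        by (subst integral_distr) auto
      also have "\<dots> = cdf (distr M borel Z) c"
        by (simp add: cdf_def)
      finally show ?thesis .
    qed
    have "(\<integral>\<omega>. h n (X \<omega>) \<partial>M) = (\<integral>\<omega>. h n (Y \<omega>) \<partial>M)" for n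
      using X Y unfolding h_def
      by (subst (1 2) integral_mult_right_zero, subst (1 2) Bochner_Integration.integral_diff)
         (auto simp only: eq intro!: integrable_abs Bochner_Integration.integrable_diff integrable_const)
    then show "cdf (distr M borel X) c = cdf (distr M borel Y) c"
      using LIMSEQ_unique[OF lim[of X], of "1 - 2 * cdf (distr M borel Y) c"] lim[of Y] by simp
  qed
qed

section \<open>Finite Borel measures and bounded continuous functions\<close>

text \<open>The closed sets generate the Borel sets and are stable under intersection, and the
  indicator of a closed set is a pointwise limit of bounded continuous functions. Dominated
  convergence carries the equality of integrals over to closed sets.\<close>

lemma finite_measure_eqI_bounded_continuous:
  fixes M N :: "'a::metric_space measure"
  assumes "finite_measure M" "finite_measure N"
    and sets_M: "sets M = sets borel" and sets_N: "sets N = sets borel"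
    and eq: "\<And>f :: 'a \<Rightarrow> real. continuous_on UNIV f \<Longrightarrow> (\<And>x. \<bar>f x\<bar> \<le> 1) \<Longrightarrow>
      (\<integral>x. f x \<partial>M) = (\<integral>x. f x \<partial>N)"
  shows "M = N"
proof (rule measure_eqI_generator_eq[where \<Omega> = UNIV and E = "Collect closed" and A = "\<lambda>_. UNIV"])
  show "Int_stable (Collect closed)"
    by (auto simp: Int_stable_def)
  show "sets M = sigma_sets UNIV (Collect closed)" "sets N = sigma_sets UNIV (Collect closed)"
    using sets_M sets_N by (simp_all add: borel_eq_closed)
  interpret M: finite_measure M by fact
  interpret N: finite_measure N by fact
  show "emeasure M UNIV \<noteq> \<infinity>" for i :: nat
    by simp
  fix C :: "'a set" assume "C \<in> Collect closed"
  then have C: "closed C" by simp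
  show "emeasure M C = emeasure N C"
  \<comment> \<open>The empty set is treated apart since \<open>infdist x {}\<close> is 0 by
    convention, which would make every \<open>h n\<close> below constantly 1.\<close>
  proof (cases "C = {}")
    case False
    \<comment> \<open>For positive n, \<open>h n\<close> is 1 on \<open>C\<close> and falls to 0 at
      distance 1/n from it. As \<open>C\<close> is closed, points off \<open>C\<close> have positive
      distance to it, so the limit there is 0.\<close>
    define h where "h n x = max 0 (1 - real n * infdist x C)" for n x
    have cont: "continuous_on UNIV (h n)" for n
      unfolding h_def by (intro continuous_intros)
    have bound: "\<bar>h n x\<bar> \<le> 1" for n x
      by (auto simp: h_def infdist_nonneg)
    have h_lim: "(\<lambda>n. h n x) \<longlonglongrightarrow> indicator C x" for x
    proof (cases "x \<in> C")
      case False
      then have pos: "0 < infdist x C"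
        using C \<open>C \<noteq> {}\<close> in_closed_iff_infdist_zero infdist_nonneg[of x C] by fastforce
      then obtain m where m: "1 < real m * infdist x C"
        using reals_Archimedean3 by blast
      have "h n x = 0" if "n \<ge> m" for n
      proof -
        have "real m * infdist x C \<le> real n * infdist x C"
          using that pos by (intro mult_right_mono) auto
        then show ?thesis using m by (simp add: h_def)
      qed
      then show ?thesis
        using False by (auto intro!: tendsto_eventually eventually_sequentiallyI)
    qed (simp add: h_def)
    have lim: "(\<lambda>n. \<integral>x. h n x \<partial>L) \<longlonglongrightarrow> measure L C"
      if "finite_measure L" and sets: "sets L = sets borel" for L
    proof -
      interpret L: finite_measure L by fact
      have [measurable_cong]: "sets L = sets borel" by fact
      have [measurable]: "h n \<in> borel_measurable borel" for n
        using cont by (rule borel_measurable_continuous_onI)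
      have [measurable]: "C \<in> sets borel" using C by simp
      have "(\<lambda>n. \<integral>x. h n x \<partial>L) \<longlonglongrightarrow> (\<integral>x. indicator C x \<partial>L)"
        by (rule integral_dominated_convergence[where w = "\<lambda>_. 1"])
           (use h_lim bound in \<open>auto\<close>)
      then show ?thesis
        using sets_eq_imp_space_eq[OF sets] by simp
    qed
    have "measure M C = measure N C"
      using LIMSEQ_unique[OF lim[OF assms(1) sets_M]] lim[OF assms(2) sets_N]
      by (simp add: eq[OF cont bound])
    then show ?thesis
      by (simp add: M.emeasure_eq_measure N.emeasure_eq_measure)
  qed simp
qed auto

section \<open>Exponential sums and the Cramer-Wold theorem on a compact set\<close>

text \<open>The linear span of exponentials of linear forms in finitely many coordinates. Each
  exponential depends on a single real linear form, so its mean is determined by the law of that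
  form; and products of exponentials are again exponentials, which makes the span an
  algebra.\<close>

inductive_set exp_span :: "(('i \<Rightarrow> real) \<Rightarrow> real) set" where
  exp: "finite J \<Longrightarrow> (\<lambda>x. exp (\<Sum>j\<in>J. t j * x j)) \<in> exp_span"
| add: "f \<in> exp_span \<Longrightarrow> g \<in> exp_span \<Longrightarrow> (\<lambda>x. f x + g x) \<in> exp_span"
| scale: "f \<in> exp_span \<Longrightarrow> (\<lambda>x. c * f x) \<in> exp_span"

lemma continuous_exp_span:
  assumes "f \<in> exp_span"
  shows "continuous_on UNIV f"
  using assms
  by induction (auto intro!: continuous_intros continuous_on_product_coordinates)

text \<open>The product of two exponentials is the exponential of the sum of the linear forms.
  Bilinearity gives the rest, by induction on \<open>f\<close> for all \<open>g\<close> and an inner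
  induction on \<open>g\<close>.\<close>

lemma exp_span_mult:
  assumes "f \<in> exp_span" "g \<in> exp_span"
  shows "(\<lambda>x. f x * g x) \<in> exp_span"
  using assms
proof (induction arbitrary: g)
  case (exp J t)
  from exp(2,1) show ?case
  proof induction
    case (exp J' t')
    \<comment> \<open>The two linear forms may use different coordinates, so both are extended by
      zero to the union of the index sets.\<close>
    let ?s = "\<lambda>j. (if j \<in> J then t j else 0) + (if j \<in> J' then t' j else 0)"
    have "(\<Sum>j\<in>J \<union> J'. ?s j * x j) = (\<Sum>j\<in>J. t j * x j) + (\<Sum>j\<in>J'. t' j * x j)" for x
    proof -
      have "(\<Sum>j\<in>J. t j * x j) = (\<Sum>j\<in>J \<union> J'. (if j \<in> J then t j else 0) * x j)"
        "(\<Sum>j\<in>J'. t' j * x j) = (\<Sum>j\<in>J \<union> J'. (if j \<in> J' then t' j else 0) * x j)"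
        using exp by (auto intro!: sum.mono_neutral_cong_left)
      then show ?thesis
        by (simp add: distrib_right sum.distrib)
    qed
    then show ?case
      using exp_span.exp[of "J \<union> J'" ?s] exp by (simp add: exp_add)
  next
    case (add f g)
    then show ?case using exp_span.add by (fastforce simp: algebra_simps)
  next
    case (scale f c)
    then show ?case using exp_span.scale[of _ c] by (fastforce simp: algebra_simps)
  qed
next
  case (add f1 f2)
  from exp_span.add[OF add.IH(1)[OF add.prems] add.IH(2)[OF add.prems]]
  show ?case by (simp add: algebra_simps)
next
  case (scale f c)
  from exp_span.scale[OF scale.IH[OF scale.prems]]
  show ?case by (simp add: algebra_simps)
qed

text \<open>This is Stone-Weierstrass on \<open>K\<close>: constants are multiples of the
  exponential of an empty sum, and distinct points are separated by the exponential of a coordinate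
  in which they differ.\<close>

lemma exp_span_dense:
  fixes K :: "('i::countable \<Rightarrow> real) set"
  assumes "compact K" "continuous_on K f" "e > 0"
  shows "\<exists>g\<in>exp_span. \<forall>x\<in>K. \<bar>f x - g x\<bar> < e"
proof -
  interpret function_ring_on exp_span K
  proof
    show "(\<lambda>_. c) \<in> exp_span" for c
      using exp_span.scale[OF exp_span.exp[of "{}"], of c] by simp
    show "\<exists>f\<in>exp_span. f x \<noteq> f y" if ne: "x \<noteq> y" for x y :: "'i \<Rightarrow> real"
    proof -
      obtain i where "x i \<noteq> y i" using ne by auto
      then show ?thesis
        using exp_span.exp[of "{i}" "\<lambda>_. 1"] by (intro bexI[of _ "\<lambda>x. exp (x i)"]) auto
    qed
  qed (use assms in \<open>auto intro: continuous_on_subset[OF continuous_exp_span] exp_span.add exp_span_mult\<close>)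
  show ?thesis using assms by (intro Stone_Weierstrass_basic)
qed

text \<open>The laws of the linear forms determine the means of all functions in
  \<open>exp_span\<close>, and uniform approximation on \<open>K\<close> extends this to all
  continuous functions. Countability of the index type makes the function space metric, as the
  criterion by bounded continuous functions requires.\<close>

lemma (in prob_space) cramer_wold_compact:
  fixes X Y :: "'a \<Rightarrow> 'i::countable \<Rightarrow> real"
  assumes X[measurable]: "X \<in> borel_measurable M" and Y[measurable]: "Y \<in> borel_measurable M"
    and K: "compact K" "\<And>\<omega>. \<omega> \<in> space M \<Longrightarrow> X \<omega> \<in> K" "\<And>\<omega>. \<omega> \<in> space M \<Longrightarrow> Y \<omega> \<in> K"
    and eq: "\<And>J t. finite J \<Longrightarrow>
      distr M borel (\<lambda>\<omega>. \<Sum>j\<in>J. t j * X \<omega> j) = distr M borel (\<lambda>\<omega>. \<Sum>j\<in>J. t j * Y \<omega> j)"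
  shows "distr M borel X = distr M borel Y"
proof (rule finite_measure_eqI_bounded_continuous)
  interpret DX: prob_space "distr M borel X" by (rule prob_space_distr) simp
  interpret DY: prob_space "distr M borel Y" by (rule prob_space_distr) simp
  show "finite_measure (distr M borel X)" "finite_measure (distr M borel Y)"
    by unfold_locales
  \<comment> \<open>Functions in \<open>exp_span\<close> can be unbounded on the whole space, but
    \<open>Z\<close> stays in \<open>K\<close>, where continuous functions are bounded.\<close>
  have int: "integrable M (\<lambda>\<omega>. f (Z \<omega>))"
    if f: "continuous_on UNIV f" and [measurable]: "Z \<in> borel_measurable M"
      and Z: "\<And>\<omega>. \<omega> \<in> space M \<Longrightarrow> Z \<omega> \<in> K" for f :: "('i \<Rightarrow> real) \<Rightarrow> real" and Z
  proof -
    have [measurable]: "f \<in> borel_measurable borel"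
      using f by (rule borel_measurable_continuous_onI)
    obtain B where "\<And>x. x \<in> K \<Longrightarrow> \<bar>f x\<bar> \<le> B"
      using compact_imp_bounded[OF compact_continuous_image[OF continuous_on_subset[OF f] K(1)]]
      by (auto simp: bounded_iff)
    then show ?thesis
      using Z by (intro integrable_const_bound[where B = B]) auto
  qed
  have span_eq: "(\<integral>\<omega>. g (X \<omega>) \<partial>M) = (\<integral>\<omega>. g (Y \<omega>) \<partial>M)" if "g \<in> exp_span" for g
    using that
  proof induction
    case (exp J t)
    have [measurable]: "(\<lambda>\<omega>. X \<omega> j) \<in> borel_measurable M" "(\<lambda>\<omega>. Y \<omega> j) \<in> borel_measurable M" for j
      using measurable_compose[OF X measurable_product_coordinates]
        measurable_compose[OF Y measurable_product_coordinates] by auto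
    have "(\<integral>\<omega>. exp (\<Sum>j\<in>J. t j * X \<omega> j) \<partial>M) =
        (\<integral>x. exp x \<partial>distr M borel (\<lambda>\<omega>. \<Sum>j\<in>J. t j * X \<omega> j))"
      by (subst integral_distr) auto
    also have "\<dots> = (\<integral>x. exp x \<partial>distr M borel (\<lambda>\<omega>. \<Sum>j\<in>J. t j * Y \<omega> j))"
      using eq[OF exp] by simp
    also have "\<dots> = (\<integral>\<omega>. exp (\<Sum>j\<in>J. t j * Y \<omega> j) \<partial>M)"
      by (subst integral_distr) auto
    finally show ?case .
  next
    case (add f g)
    then show ?case
      using int[OF continuous_exp_span X K(2)] int[OF continuous_exp_span Y K(3)] by simp
  qed simp
  fix f :: "('i \<Rightarrow> real) \<Rightarrow> real"
  assume f: "continuous_on UNIV f"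
  have [measurable]: "f \<in> borel_measurable borel"
    using f by (rule borel_measurable_continuous_onI)
  \<comment> \<open>Replacing \<open>f\<close> by a uniform approximation \<open>g\<close> from
    \<open>exp_span\<close> costs e/2 for \<open>X\<close> and e/2 for \<open>Y\<close>, while the
    two means of \<open>g\<close> agree.\<close>
  have "\<bar>(\<integral>\<omega>. f (X \<omega>) \<partial>M) - (\<integral>\<omega>. f (Y \<omega>) \<partial>M)\<bar> \<le> e" if e: "e > 0" for e
  proof -
    obtain g where g: "g \<in> exp_span" and g_bound: "\<And>x. x \<in> K \<Longrightarrow> \<bar>f x - g x\<bar> < e / 2"
      using exp_span_dense[OF K(1) continuous_on_subset[OF f], of "e / 2"] half_gt_zero[OF e] by blast
    have approx: "\<bar>(\<integral>\<omega>. f (Z \<omega>) \<partial>M) - (\<integral>\<omega>. g (Z \<omega>) \<partial>M)\<bar> \<le> e / 2"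
      if Z[measurable]: "Z \<in> borel_measurable M" "\<And>\<omega>. \<omega> \<in> space M \<Longrightarrow> Z \<omega> \<in> K" for Z
    proof -
      note ints = int[OF f Z] int[OF continuous_exp_span[OF g] Z]
      have "\<bar>(\<integral>\<omega>. f (Z \<omega>) \<partial>M) - (\<integral>\<omega>. g (Z \<omega>) \<partial>M)\<bar> = \<bar>\<integral>\<omega>. f (Z \<omega>) - g (Z \<omega>) \<partial>M\<bar>"
        using ints by simp
      also have "\<dots> \<le> (\<integral>\<omega>. \<bar>f (Z \<omega>) - g (Z \<omega>)\<bar> \<partial>M)"
        by (rule integral_abs_bound)
      also have "\<dots> \<le> (\<integral>\<omega>. e / 2 \<partial>M)"
        using ints Z by (intro integral_mono) (auto intro: less_imp_le[OF g_bound] simp del: less_divide_eq_numeral1 le_divide_eq_numeral1)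
      finally show ?thesis by (simp add: prob_space)
    qed
    show ?thesis
      using approx[OF X K(2)] approx[OF Y K(3)] span_eq[OF g] by linarith
  qed
  then have "(\<integral>\<omega>. f (X \<omega>) \<partial>M) = (\<integral>\<omega>. f (Y \<omega>) \<partial>M)"
    using field_le_epsilon[of "\<bar>(\<integral>\<omega>. f (X \<omega>) \<partial>M) - (\<integral>\<omega>. f (Y \<omega>) \<partial>M)\<bar>" 0] by simp
  then show "(\<integral>x. f x \<partial>distr M borel X) = (\<integral>x. f x \<partial>distr M borel Y)"
    by (simp add: integral_distr)
qed simp_all

text \<open>Tychonoff's theorem, carried over from the abstract product topology to the topology of
  the function type.\<close>

lemma compact_Pi_UNIV:
  assumes "\<And>i. compact (K i)"
  shows "compact (Pi UNIV K :: ('i \<Rightarrow> 'b::topological_space) set)"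
  using assms compactin_PiE[of "\<lambda>_. euclidean" UNIV K]
  by (auto simp: euclidean_product_topology PiE_UNIV_domain compactin_euclidean_iff)

theorem theorem2p14:
  fixes \<mu> :: "'s measure" and P :: "'w measure" and \<xi> :: "'w \<Rightarrow> 's measure"
  assumes "finite_measure \<mu>"
    and "prob_space P"
    and "random_measure P \<mu> \<xi>"
    and "swap_invariant \<mu> P \<xi>"
    and "0 < (\<integral>\<^sup>+\<omega>. emeasure (\<xi> \<omega>) (space \<mu>) \<partial>P)"
    and "(\<integral>\<^sup>+\<omega>. emeasure (\<xi> \<omega>) (space \<mu>) \<partial>P) < \<infinity>"
  shows "\<exists>\<eta>. random_measure P \<mu> \<eta> \<and>
    exchangeable \<mu>
      (density P (\<lambda>\<omega>. emeasure (\<xi> \<omega>) (space \<mu>) / (\<integral>\<^sup>+\<omega>'. emeasure (\<xi> \<omega>') (space \<mu>) \<partial>P))) \<eta> \<and>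
    (AE \<omega> in P. \<xi> \<omega> = scale_measure (emeasure (\<xi> \<omega>) (space \<mu>)) (\<eta> \<omega>))"
proof -

  \<comment> \<open>The total mass and the normalised random measure\<close>
  interpret \<mu>: finite_measure \<mu> by fact
  interpret P: prob_space P by fact
  have sets_\<xi>: "sets (\<xi> \<omega>) = sets \<mu>" if "\<omega> \<in> space P" for \<omega>
    using assms(3) that by (simp add: random_measure_def)
  have meas_\<xi>[measurable]: "(\<lambda>\<omega>. emeasure (\<xi> \<omega>) A) \<in> borel_measurable P" if "A \<in> sets \<mu>" for A
    using assms(3) that by (simp add: random_measure_def)
  have meas_\<xi>'[measurable]: "(\<lambda>\<omega>. measure (\<xi> \<omega>) A) \<in> borel_measurable P" if "A \<in> sets \<mu>" for A
    using that unfolding measure_def by measurable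
  have space_\<mu>[measurable]: "space \<mu> \<in> sets \<mu>" by simp
  define T where "T \<omega> = emeasure (\<xi> \<omega>) (space \<mu>)" for \<omega>
  define m where "m = (\<integral>\<^sup>+\<omega>. T \<omega> \<partial>P)"
  define r where "r = enn2real m"
  have T[measurable]: "T \<in> borel_measurable P"
    unfolding T_def by (rule meas_\<xi>) simp
  have m: "0 < m" "m < \<infinity>"
    using assms(5,6) by (auto simp: m_def T_def)
  have r: "0 < r" "m = ennreal r"
    using m by (auto simp: r_def enn2real_positive_iff less_top)
  have T_fin: "AE \<omega> in P. T \<omega> \<noteq> \<infinity>"
    using m by (intro nn_integral_noteq_infinite) (auto simp: m_def)
  have \<xi>_le: "emeasure (\<xi> \<omega>) A \<le> T \<omega>" if "\<omega> \<in> space P" for \<omega> A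
    using emeasure_space[of "\<xi> \<omega>" A] sets_eq_imp_space_eq[OF sets_\<xi>[OF that]] by (simp add: T_def)
  \<comment> \<open>The null measure is a harmless default with the right sigma-algebra: where
    \<open>T\<close> is 0, \<xi> itself vanishes and \<open>\<xi> = T \<eta>\<close> persists, and
    \<open>T\<close> is infinite only on a \<open>P\<close>-null set.\<close>
  define \<eta> where "\<eta> \<omega> = (if T \<omega> = 0 \<or> T \<omega> = \<infinity> then null_measure \<mu>
    else scale_measure (inverse (T \<omega>)) (\<xi> \<omega>))" for \<omega>
  define Q where "Q = density P (\<lambda>\<omega>. T \<omega> / m)"
  have T_inverse: "T \<omega> * inverse (T \<omega>) = 1" if "T \<omega> \<noteq> 0" "T \<omega> \<noteq> \<infinity>" for \<omega>
    using that ennreal_divide_self[of "T \<omega>"] by (simp add: divide_ennreal_def less_top)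
  have emeasure_\<eta>: "emeasure (\<eta> \<omega>) A = (if T \<omega> = 0 \<or> T \<omega> = \<infinity> then 0 else inverse (T \<omega>) * emeasure (\<xi> \<omega>) A)"
    for \<omega> A
    by (simp add: \<eta>_def)
  have rm: "random_measure P \<mu> \<eta>"
    unfolding random_measure_def emeasure_\<eta> by (auto simp: \<eta>_def sets_\<xi>)
  have meas_\<eta>[measurable]: "(\<lambda>\<omega>. emeasure (\<eta> \<omega>) A) \<in> borel_measurable P" if "A \<in> sets \<mu>" for A
    using rm that by (simp add: random_measure_def)
  have meas_\<eta>'[measurable]: "(\<lambda>\<omega>. measure (\<eta> \<omega>) A) \<in> borel_measurable P" if "A \<in> sets \<mu>" for A
    using that unfolding measure_def by measurable
  \<comment> \<open>This bound puts the vectors of values of \<eta> into a cube, the compact set on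
    which the Cramer-Wold argument will run.\<close>
  have \<eta>_le_1: "emeasure (\<eta> \<omega>) A \<le> 1" if "\<omega> \<in> space P" for \<omega> A
  proof (cases "T \<omega> = 0 \<or> T \<omega> = \<infinity>")
    case False
    then have "inverse (T \<omega>) * emeasure (\<xi> \<omega>) A \<le> inverse (T \<omega>) * T \<omega>"
      by (intro mult_left_mono \<xi>_le that) simp
    also have "\<dots> = 1"
      using False T_inverse by (simp add: mult.commute)
    finally show ?thesis using False by (simp add: emeasure_\<eta>)
  qed (auto simp: emeasure_\<eta>)
  have \<eta>_real: "emeasure (\<eta> \<omega>) A = ennreal (measure (\<eta> \<omega>) A)" "measure (\<eta> \<omega>) A \<le> 1"
    if "\<omega> \<in> space P" for \<omega> A
  proof -
    have "emeasure (\<eta> \<omega>) A \<noteq> \<infinity>"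
      using \<eta>_le_1[OF that, of A] by (auto simp: top_unique)
    then show *: "emeasure (\<eta> \<omega>) A = ennreal (measure (\<eta> \<omega>) A)"
      by (simp add: emeasure_eq_ennreal_measure)
    show "measure (\<eta> \<omega>) A \<le> 1"
      using \<eta>_le_1[OF that, of A] unfolding * by simp
  qed
  have \<xi>_real: "measure (\<xi> \<omega>) A = enn2real (T \<omega>) * measure (\<eta> \<omega>) A"
    if "\<omega> \<in> space P" "T \<omega> \<noteq> \<infinity>" for \<omega> A
  proof (cases "T \<omega> = 0")
    case True
    then show ?thesis using \<xi>_le[OF that(1), of A] by (simp add: measure_def)
  next
    case False
    then have "T \<omega> * emeasure (\<eta> \<omega>) A = (T \<omega> * inverse (T \<omega>)) * emeasure (\<xi> \<omega>) A"
      using that by (simp add: emeasure_\<eta> mult.assoc)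
    also have "T \<omega> * inverse (T \<omega>) = 1"
      using False that T_inverse by simp
    finally show ?thesis
      by (simp add: measure_def flip: enn2real_mult)
  qed
  have scaled: "AE \<omega> in P. \<xi> \<omega> = scale_measure (T \<omega>) (\<eta> \<omega>)"
    using T_fin AE_space
  proof eventually_elim
    case (elim \<omega>)
    show ?case
    proof (rule measure_eqI)
      show "sets (\<xi> \<omega>) = sets (scale_measure (T \<omega>) (\<eta> \<omega>))"
        using elim by (simp add: \<eta>_def sets_\<xi>)
      fix A
      show "emeasure (\<xi> \<omega>) A = emeasure (scale_measure (T \<omega>) (\<eta> \<omega>)) A"
      proof (cases "T \<omega> = 0")
        case True
        then show ?thesis using \<xi>_le[OF elim(2), of A] by simp
      next
        case False
        then have "T \<omega> * inverse (T \<omega>) = 1"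
          using elim T_inverse by simp
        then show ?thesis
          using False elim by (simp add: emeasure_\<eta> flip: mult.assoc)
      qed
    qed
  qed

  \<comment> \<open>The probability measure \<open>Q\<close>\<close>
  \<comment> \<open>Bochner integrals with respect to \<open>Q\<close> are computed from a
    real-valued density. Since \<open>T\<close> is almost surely finite, \<open>enn2real\<close>
    changes the density only on a null set.\<close>
  have Q_real: "Q = density P (\<lambda>\<omega>. ennreal (enn2real (T \<omega>) / r))"
    unfolding Q_def
  proof (rule density_cong)
    show "AE \<omega> in P. T \<omega> / m = ennreal (enn2real (T \<omega>) / r)"
      using T_fin
    proof eventually_elim
      case (elim \<omega>)
      then have "T \<omega> = ennreal (enn2real (T \<omega>))" by (simp add: less_top)
      then show ?case
        using r by (metis divide_ennreal enn2real_nonneg)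
    qed
  qed measurable
  interpret Q: prob_space Q
  proof
    have "emeasure Q (space Q) = (\<integral>\<^sup>+\<omega>. T \<omega> / m \<partial>P)"
      unfolding Q_def by (simp add: emeasure_density cong: nn_integral_cong)
    also have "\<dots> = m / m"
      by (subst nn_integral_divide) (auto simp: m_def)
    also have "\<dots> = 1"
      using m by (intro ennreal_divide_self) auto
    finally show "emeasure Q (space Q) = 1" .
  qed
  have [measurable_cong]: "sets Q = sets P" by (simp add: Q_def)
  have space_Q: "space Q = space P" by (simp add: Q_def)

  \<comment> \<open>Absolute moments under \<open>Q\<close> in terms of \<xi>\<close>
  \<comment> \<open>The finite mean of \<open>T\<close> settles the finiteness conditions of
    swap-invariance for all sets at once.\<close>
  have \<xi>_fin: "(\<integral>\<^sup>+\<omega>. emeasure (\<xi> \<omega>) A \<partial>P) < \<infinity>" for A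
    using nn_integral_mono[of P "\<lambda>\<omega>. emeasure (\<xi> \<omega>) A" T] \<xi>_le m by (auto simp: m_def intro: le_less_trans)

  \<comment> \<open>\<open>A\<close> is completed to a partition of the space, so that the constant \<open>c\<close> becomes a
    multiple of the total mass of \<open>\<xi>\<close>.\<close>
  define A' where "A' n A = A(Suc n := space \<mu> - (\<Union>j\<in>{1..n}. A j))" for n :: nat and A :: "nat \<Rightarrow> 's set"
  define u where "u n c t j = (if j = Suc n then - c else t j - c)" for n :: nat and c :: real and t :: "nat \<Rightarrow> real" and j
  have A'_sets: "\<forall>j\<in>{1..Suc n}. A' n A j \<in> sets \<mu>" if "\<forall>j\<in>{1..n}. A j \<in> sets \<mu>" for n A
    using that by (auto simp: A'_def)
  have A'_disj: "disjoint_family_on (A' n A) {1..Suc n}" if "disjoint_family_on A {1..n}" for n A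
  proof -
    have "disjoint_family_on (A' n A) {1..n}"
      using that by (simp add: disjoint_family_on_def A'_def)
    moreover have "A' n A (Suc n) \<inter> (\<Union>j\<in>{1..n}. A' n A j) = {}"
      by (auto simp: A'_def)
    ultimately show ?thesis
      by (simp add: atLeastAtMostSuc_conv disjoint_family_on_insert)
  qed
  \<comment> \<open>The density \<open>T / r\<close> undoes the normalisation: T |\<Sum> t_j
    \<eta>(A_j) - c| = |\<Sum> t_j \<xi>(A_j) - c T|. The coefficients \<open>u\<close> subtract
    \<open>c\<close> on every cell of the partition, and the masses of the cells add up to
    \<open>T\<close>, which yields the term c T.\<close>
  have abs_moment: "(\<integral>\<omega>. \<bar>(\<Sum>j=1..n. t j * measure (\<eta> \<omega>) (A j)) - c\<bar> \<partial>Q) =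
      (\<integral>\<omega>. \<bar>\<Sum>j=1..Suc n. u n c t j * measure (\<xi> \<omega>) (A' n A j)\<bar> \<partial>P) / r"
    if A: "\<forall>j\<in>{1..n}. A j \<in> sets \<mu>" "disjoint_family_on A {1..n}" for n A t c
  proof -
    have [measurable]: "A j \<in> sets \<mu>" if "j \<in> {1..n}" for j
      using A that by auto
    have U: "(\<Union>j\<in>{1..n}. A j) \<in> sets \<mu>" "(\<Union>j\<in>{1..n}. A j) \<subseteq> space \<mu>"
      using A(1) sets.sets_into_space by blast+
    have [measurable]: "A' n A j \<in> sets \<mu>" if "j \<in> {1..Suc n}" for j
      using A'_sets[OF A(1)] that by blast
    have "(\<integral>\<omega>. \<bar>(\<Sum>j=1..n. t j * measure (\<eta> \<omega>) (A j)) - c\<bar> \<partial>Q) =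
        (\<integral>\<omega>. enn2real (T \<omega>) / r * \<bar>(\<Sum>j=1..n. t j * measure (\<eta> \<omega>) (A j)) - c\<bar> \<partial>P)"
      unfolding Q_real using r by (subst integral_real_density) (auto intro!: AE_I2)
    also have "\<dots> = (\<integral>\<omega>. \<bar>\<Sum>j=1..Suc n. u n c t j * measure (\<xi> \<omega>) (A' n A j)\<bar> / r \<partial>P)"
    proof (rule integral_cong_AE)
      show "AE \<omega> in P. enn2real (T \<omega>) / r * \<bar>(\<Sum>j=1..n. t j * measure (\<eta> \<omega>) (A j)) - c\<bar> =
        \<bar>\<Sum>j=1..Suc n. u n c t j * measure (\<xi> \<omega>) (A' n A j)\<bar> / r"
        using T_fin AE_space
      proof eventually_elim
        case (elim \<omega>)
        interpret \<xi>: finite_measure "\<xi> \<omega>"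
          using elim sets_eq_imp_space_eq[OF sets_\<xi>, of \<omega>] by (intro finite_measureI) (simp add: T_def)
        have "measure (\<xi> \<omega>) (space \<mu> - (\<Union>j\<in>{1..n}. A j)) =
            measure (\<xi> \<omega>) (space \<mu>) - measure (\<xi> \<omega>) (\<Union>j\<in>{1..n}. A j)"
          using U sets_\<xi>[OF elim(2)] by (intro \<xi>.finite_measure_Diff) auto
        also have "measure (\<xi> \<omega>) (\<Union>j\<in>{1..n}. A j) = (\<Sum>j=1..n. measure (\<xi> \<omega>) (A j))"
          using A elim by (intro \<xi>.finite_measure_finite_Union) (auto simp: sets_\<xi>)
        also have "measure (\<xi> \<omega>) (space \<mu>) = enn2real (T \<omega>)"
          by (simp add: T_def measure_def)
        finally have compl: "measure (\<xi> \<omega>) (space \<mu> - (\<Union>j\<in>{1..n}. A j)) =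
            enn2real (T \<omega>) - (\<Sum>j=1..n. measure (\<xi> \<omega>) (A j))" .
        have "(\<Sum>j=1..Suc n. u n c t j * measure (\<xi> \<omega>) (A' n A j)) =
            (\<Sum>j=1..n. (t j - c) * measure (\<xi> \<omega>) (A j)) - c * measure (\<xi> \<omega>) (space \<mu> - (\<Union>j\<in>{1..n}. A j))"
          by (simp add: u_def A'_def)
        also have "\<dots> = (\<Sum>j=1..n. t j * measure (\<xi> \<omega>) (A j)) - c * enn2real (T \<omega>)"
          unfolding compl by (simp add: left_diff_distrib right_diff_distrib sum_subtractf sum_distrib_left)
        also have "\<dots> = enn2real (T \<omega>) * ((\<Sum>j=1..n. t j * measure (\<eta> \<omega>) (A j)) - c)"
          using elim by (simp add: \<xi>_real algebra_simps sum_distrib_left)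
        finally show ?case by (simp add: abs_mult)
      qed
    qed measurable
    finally show ?thesis by simp
  qed

  \<comment> \<open>Exchangeability of \<eta> under \<open>Q\<close>\<close>
  have "exchangeable \<mu> Q \<eta>"
    unfolding exchangeable_def
  proof (intro allI impI)
    fix n :: nat and A B :: "nat \<Rightarrow> 's set"
    assume sets: "\<forall>j\<in>{1..n}. A j \<in> sets \<mu> \<and> B j \<in> sets \<mu>"
      and A_disj: "disjoint_family_on A {1..n}" and B_disj: "disjoint_family_on B {1..n}"
      and \<mu>_eq: "\<forall>j\<in>{1..n}. emeasure \<mu> (A j) = emeasure \<mu> (B j)"
    have A_sets: "\<forall>j\<in>{1..n}. A j \<in> sets \<mu>" and B_sets: "\<forall>j\<in>{1..n}. B j \<in> sets \<mu>"
      using sets by auto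
    \<comment> \<open>Finiteness of \<mu> allows the subtraction. The mass of the leftover cell is
      thus fixed by the masses of the other cells, so the two completed partitions match cell by
      cell.\<close>
    have \<mu>_compl: "emeasure \<mu> (space \<mu> - (\<Union>j\<in>{1..n}. C j)) = emeasure \<mu> (space \<mu>) - (\<Sum>j=1..n. emeasure \<mu> (C j))"
      if "\<forall>j\<in>{1..n}. C j \<in> sets \<mu>" "disjoint_family_on C {1..n}" for C
    proof -
      have "(\<Sum>j=1..n. emeasure \<mu> (C j)) = emeasure \<mu> (\<Union>j\<in>{1..n}. C j)"
        using that by (intro sum_emeasure) auto
      then show ?thesis
        using that by (subst emeasure_compl) auto
    qed
    have \<mu>_eq': "emeasure \<mu> (A' n A j) = emeasure \<mu> (A' n B j)" if "j \<in> {1..Suc n}" for j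
      using that \<mu>_compl[OF A_sets A_disj] \<mu>_compl[OF B_sets B_disj] \<mu>_eq by (auto simp: A'_def)
    have swap: "(\<integral>\<omega>. \<bar>\<Sum>j=1..Suc n. v j * measure (\<xi> \<omega>) (A' n A j)\<bar> \<partial>P) =
        (\<integral>\<omega>. \<bar>\<Sum>j=1..Suc n. v j * measure (\<xi> \<omega>) (A' n B j)\<bar> \<partial>P)" for v
      by (rule assms(4)[unfolded swap_invariant_def, rule_format])
         (use A'_sets[OF A_sets] A'_sets[OF B_sets] A'_disj[OF A_disj] A'_disj[OF B_disj] \<mu>_eq' \<xi>_fin
          in auto)
    \<comment> \<open>The values of \<eta> are padded with zeros to a real sequence, so that they
      form a point of a function space over a countable index type, in the cube with sides
      [0,1].\<close>
    define X where "X C \<omega> j = (if j \<in> {1..n} then measure (\<eta> \<omega>) (C j) else 0)"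
      for C :: "nat \<Rightarrow> 's set" and \<omega> and j :: nat
    have X_coord[measurable]: "(\<lambda>\<omega>. X C \<omega> j) \<in> borel_measurable Q" if "\<forall>j\<in>{1..n}. C j \<in> sets \<mu>" for C j
      using that unfolding X_def by (cases "j \<in> {1..n}") auto
    have X_meas[measurable]: "X C \<in> borel_measurable Q" if "\<forall>j\<in>{1..n}. C j \<in> sets \<mu>" for C
      using X_coord[OF that] by (rule measurable_coordinatewise_then_product)
    have X_bound: "0 \<le> X C \<omega> j" "X C \<omega> j \<le> 1" if "\<omega> \<in> space Q" for C \<omega> j
      using \<eta>_real(2) that by (auto simp: X_def space_Q)
    have "distr Q borel (X A) = distr Q borel (X B)"
    proof (rule Q.cramer_wold_compact)
      show "X A \<in> borel_measurable Q" "X B \<in> borel_measurable Q"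
        using A_sets B_sets by (auto intro: X_meas)
      show "compact (Pi UNIV (\<lambda>_. {0..1}) :: (nat \<Rightarrow> real) set)"
        by (intro compact_Pi_UNIV) simp
      show "X A \<omega> \<in> Pi UNIV (\<lambda>_. {0..1})" "X B \<omega> \<in> Pi UNIV (\<lambda>_. {0..1})" if "\<omega> \<in> space Q" for \<omega>
        using X_bound[OF that] by auto
      fix J :: "nat set" and t :: "nat \<Rightarrow> real"
      assume J: "finite J"
      \<comment> \<open>An arbitrary finite index set is reduced to the range 1..n used in
        \<open>abs_moment\<close>: \<open>X\<close> vanishes outside 1..n, and \<open>s\<close>
        vanishes outside \<open>J\<close>.\<close>
      define s where "s j = (if j \<in> J then t j else 0)" for j
      have sum_eq: "(\<Sum>j\<in>J. t j * X C \<omega> j) = (\<Sum>j=1..n. s j * measure (\<eta> \<omega>) (C j))" for C \<omega>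
      proof -
        have "(\<Sum>j\<in>J. t j * X C \<omega> j) = (\<Sum>j\<in>J \<inter> {1..n}. t j * measure (\<eta> \<omega>) (C j))"
          using J by (intro sum.mono_neutral_cong_right) (auto simp: X_def)
        also have "\<dots> = (\<Sum>j=1..n. s j * measure (\<eta> \<omega>) (C j))"
          by (intro sum.mono_neutral_cong_left) (auto simp: s_def)
        finally show ?thesis .
      qed
      have X_int: "integrable Q (\<lambda>\<omega>. \<Sum>j\<in>J. t j * X C \<omega> j)" if "\<forall>j\<in>{1..n}. C j \<in> sets \<mu>" for C
        using X_coord[OF that] X_bound
        by (intro Bochner_Integration.integrable_sum integrable_mult_right Q.integrable_const_bound[where B = 1]) auto
      show "distr Q borel (\<lambda>\<omega>. \<Sum>j\<in>J. t j * X A \<omega> j) = distr Q borel (\<lambda>\<omega>. \<Sum>j\<in>J. t j * X B \<omega> j)"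
      proof (rule Q.distr_eqI_abs_moments)
        \<comment> \<open>Swap-invariance enters here, for the completed partitions and the
          coefficients \<open>v = u n c s\<close>.\<close>
        show "(\<integral>\<omega>. \<bar>(\<Sum>j\<in>J. t j * X A \<omega> j) - c\<bar> \<partial>Q) = (\<integral>\<omega>. \<bar>(\<Sum>j\<in>J. t j * X B \<omega> j) - c\<bar> \<partial>Q)" for c
          unfolding sum_eq abs_moment[OF A_sets A_disj] abs_moment[OF B_sets B_disj] swap ..
      qed (use X_int A_sets B_sets in auto)
    qed
    \<comment> \<open>The tuple in the definition of exchangeability is a measurable image of
      \<open>X C\<close>: since \<eta> is finite, its extended values are recovered from the real
      ones by \<open>ennreal\<close>. Equality of the laws of \<open>X A\<close> and
      \<open>X B\<close> thus passes to the tuples.\<close>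
    moreover have "distr Q (\<Pi>\<^sub>M j\<in>{1..n}. borel) (\<lambda>\<omega>. \<lambda>j\<in>{1..n}. emeasure (\<eta> \<omega>) (C j)) =
        distr (distr Q borel (X C)) (\<Pi>\<^sub>M j\<in>{1..n}. borel) (\<lambda>x. \<lambda>j\<in>{1..n}. ennreal (x j))"
      if C: "\<forall>j\<in>{1..n}. C j \<in> sets \<mu>" for C
    proof -
      have [measurable]: "(\<lambda>x :: nat \<Rightarrow> real. \<lambda>j\<in>{1..n}. ennreal (x j)) \<in> borel \<rightarrow>\<^sub>M (\<Pi>\<^sub>M j\<in>{1..n}. borel)"
        by (intro measurable_restrict measurable_compose[OF measurable_product_coordinates]) auto
      show ?thesis
        using X_meas[OF C]
        by (subst distr_distr) (auto intro!: distr_cong restrict_ext simp: space_Q X_def \<eta>_real(1))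
    qed
    ultimately show "distr Q (\<Pi>\<^sub>M j\<in>{1..n}. borel) (\<lambda>\<omega>. \<lambda>j\<in>{1..n}. emeasure (\<eta> \<omega>) (A j)) =
        distr Q (\<Pi>\<^sub>M j\<in>{1..n}. borel) (\<lambda>\<omega>. \<lambda>j\<in>{1..n}. emeasure (\<eta> \<omega>) (B j))"
      using A_sets B_sets by simp
  qed
  then show ?thesis
    using rm scaled unfolding Q_def m_def T_def by blast
qed

end
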